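(* 1. For every real $b \in \Big(\sqrt{2-2 \sin(\frac{18 \pi}{325})},\ \frac{\sqrt{7}}{2} \Big]$ $(\approx (1.28599,1.32287])$ it holds that $\chi(G_{[1,b]}) = 7$. 2. For every real $b \in \Big(\sqrt{2+2\sin(\frac{7\pi}{45})},\ \sqrt{3} \Big]$ $(\approx (1.71433, 1.73205])$ it holds that $\chi(G_{[1,b]}) = 9$.
   Context: For real $b>1$, $G_{[1,b]}$ is the graph with vertex set $\mathbb{R}^2$ in which two points $x,y$ are adjacent if and only if their Euclidean distance satisfies $1\le \mathrm{dist}(x,y)\le b$. A proper coloring of a graph is an arbitrary function from its vertex set to a set of colors (no measurability or regularity is required) giving different colors to adjacent vertices; $\chi(G)$ denotes the chromatic number, i.e. the minimal cardinality of a set of colors for which a proper coloring of $G$ exists. *)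

theory Defs
  imports "HOL-Analysis.Analysis" "HOL-Library.Extended_Nat"
begin

definition proper_coloring :: "'v set \<Rightarrow> ('v \<Rightarrow> 'v \<Rightarrow> bool) \<Rightarrow> 'c set \<Rightarrow> ('v \<Rightarrow> 'c) \<Rightarrow> bool" where
  "proper_coloring V adj C f \<longleftrightarrow>
     f \<in> V \<rightarrow> C \<and> (\<forall>x\<in>V. \<forall>y\<in>V. adj x y \<longrightarrow> f x \<noteq> f y)"

text \<open>
  Every finite cardinality is attained by a finite set of natural numbers, so taking the colors from
  \<^typ>\<open>nat\<close> loses no generality. The infimum over the empty set is \<open>\<infinity>\<close>: all
  infinite chromatic numbers are identified.
\<close>
definition chromatic_number :: "'v set \<Rightarrow> ('v \<Rightarrow> 'v \<Rightarrow> bool) \<Rightarrow> enat" where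
  "chromatic_number V adj =
     Inf {enat (card C) | C :: nat set. finite C \<and> (\<exists>f. proper_coloring V adj C f)}"

definition adj_interval :: "real \<Rightarrow> real ^ 2 \<Rightarrow> real ^ 2 \<Rightarrow> bool" where
  "adj_interval b x y \<longleftrightarrow> 1 \<le> dist x y \<and> dist x y \<le> b"

definition chi_plane :: "real \<Rightarrow> enat" where
  "chi_plane b = chromatic_number (UNIV :: (real ^ 2) set) (adj_interval b)"

end

theory Submission
  imports Defs
begin

text \<open>
  Upper bounds: color the hexagons of diameter 1 of a hexagonal tiling according to a sublattice of
  index 7 or 9.

  Lower bounds: in a coloring of the plane by \<open>k\<close> colors there are points of three different colors
  arbitrarily close to some point \<open>a\<close>. Otherwise monochromatic clusters, whose diameter is below 1,
  could be contracted to single points, giving a continuous map from a disc into a finite union of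
  segments which moves no point far, and Brouwer's theorem forbids this. Hence only \<open>k - 3\<close> colors
  occur in the annulus around \<open>a\<close>. On a circle inside this annulus two of them come together at a
  point \<open>w\<close>, and both are absent from the annulus around \<open>w\<close>. For \<open>k = 6\<close> this is contradictory on 18
  points of a circle, for \<open>k = 8\<close> on three concentric circles with 240 points each.
\<close>

section \<open>Hexagonal colorings\<close>

text \<open>
  In the coordinates \<open>hexA\<close> and \<open>hexB\<close> the regular hexagon of diameter 1 around the origin is
  given by \<open>\<bar>a\<bar>, \<bar>b\<bar>, \<bar>b - a\<bar> \<le> 1/2\<close>, and the centers of the tiling are the points with \<open>a = i + j / 2\<close> and
  \<open>b = i / 2 + j\<close>.
\<close>

definition hexA :: "real ^ 2 \<Rightarrow> real" where "hexA x = 2 / sqrt 3 * x $ 1"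
definition hexB :: "real ^ 2 \<Rightarrow> real" where "hexB x = x $ 1 / sqrt 3 + x $ 2"

text \<open>The norm form of the Eisenstein integers: the squared modulus of
  \<open>a + b * \<omega>\<close> for a primitive cube root of unity
  \<open>\<omega>\<close>.\<close>

definition eis :: "real \<Rightarrow> real \<Rightarrow> real" where "eis a b = a\<^sup>2 - a * b + b\<^sup>2"

lemma dist_sq_eis: "(dist x y)\<^sup>2 = eis (hexA x - hexA y) (hexB x - hexB y)"
proof -
  define u v where "u = (x $ 1 - y $ 1) / sqrt 3" and "v = x $ 2 - y $ 2"
  have "x $ 1 - y $ 1 = sqrt 3 * u" by (simp add: u_def)
  hence "(dist x y)\<^sup>2 = (sqrt 3 * u)\<^sup>2 + v\<^sup>2"
    by (simp add: dist_norm norm_eq_sqrt_inner inner_vec_def sum_2 v_def power2_eq_square)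
  also have "\<dots> = eis (2 * u) (u + v)" by (simp add: eis_def power2_eq_square algebra_simps)
  also have "2 * u = hexA x - hexA y" by (simp add: hexA_def u_def diff_divide_distrib right_diff_distrib)
  also have "u + v = hexB x - hexB y" by (simp add: hexB_def u_def v_def diff_divide_distrib)
  finally show ?thesis .
qed

lemma eis_ge_first: "eis a b \<ge> 3 / 4 * a\<^sup>2"
proof -
  have "eis a b - 3 / 4 * a\<^sup>2 = (a / 2 - b)\<^sup>2" by (simp add: eis_def power2_eq_square field_simps)
  thus ?thesis by (smt (verit) zero_le_power2)
qed

lemma eis_swap: "eis a b = eis b a" and eis_rotate: "eis a b = eis (b - a) b"
  by (simp_all add: eis_def power2_eq_square algebra_simps)

text \<open>One of \<open>a * (b - a)\<close>, \<open>b * (a - b)\<close> and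
  \<open>- (a * b)\<close> is nonnegative, and subtracting it from the square of \<open>b\<close>,
  \<open>a\<close> or \<open>b - a\<close> respectively leaves \<open>eis a b\<close>. Hence two
  points of one cell have distance below 1.\<close>

lemma eis_less_1:
  assumes "\<bar>a\<bar> < 1" "\<bar>b\<bar> < 1" "\<bar>b - a\<bar> < 1"
  shows "eis a b < 1"
proof -
  have sq: "a\<^sup>2 < 1" "b\<^sup>2 < 1" "(b - a)\<^sup>2 < 1" using assms by (simp_all add: abs_square_less_1)
  have e: "eis a b = b\<^sup>2 - a * (b - a)" "eis a b = a\<^sup>2 - b * (a - b)" "eis a b = (b - a)\<^sup>2 + a * b"
    by (simp_all add: eis_def power2_eq_square algebra_simps)
  consider "0 \<le> a * (b - a)" | "0 \<le> b * (a - b)" | "a * b \<le> 0"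
    by (smt (verit) mult_nonneg_nonneg mult_nonneg_nonpos mult_nonpos_nonpos mult_nonneg_nonpos2)
  thus ?thesis using sq e by cases linarith+
qed

text \<open>The value 7/4 is taken at \<open>(3/2, 1)\<close>; expanding there leaves positive
  linear terms and a nonnegative quadratic form. This is the gap between nearest cells of equal
  color in the coloring with 7 colors.\<close>

lemma eis_gt:
  assumes "3 / 2 < p" "1 < q" shows "7 / 4 < eis p q"
proof -
  define x y where "x = p - 3 / 2" and "y = q - 1"
  have "eis p q = 7 / 4 + (2 * x + y / 2) + ((x - y / 2)\<^sup>2 + 3 / 4 * y\<^sup>2)"
    by (simp add: eis_def x_def y_def power2_eq_square field_simps)
  moreover have "0 \<le> (x - y / 2)\<^sup>2 + 3 / 4 * y\<^sup>2" by simp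
  moreover have "0 < x" "0 < y" using assms by (auto simp: x_def y_def)
  ultimately show ?thesis by linarith
qed

text \<open>Half-open, so that coordinates within one cell differ by strictly less than 1; this
  strictness lets the upper bounds include \<open>sqrt 7 / 2\<close> and
  \<open>sqrt 3\<close>.\<close>

definition in_hex :: "real \<Rightarrow> real \<Rightarrow> bool" where
  "in_hex a b \<longleftrightarrow> {a, b, b - a} \<subseteq> {- 1/2 ..< 1/2}"

text \<open>The lattice coordinates of the point are split into integer parts \<open>m\<close>,
  \<open>n\<close> and fractional parts \<open>s\<close>, \<open>t\<close>. The four cases assign it
  to the cell of one corner of its fundamental parallelogram.\<close>

lemma hexagon_cover: "\<exists>(i::int) (j::int). in_hex (a - (i + j / 2)) (b - (i / 2 + j))"
proof -
  define m n where "m = \<lfloor>(4 * a - 2 * b) / 3\<rfloor>" and "n = \<lfloor>(4 * b - 2 * a) / 3\<rfloor>"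
  define s t where "s = (4 * a - 2 * b) / 3 - m" and "t = (4 * b - 2 * a) / 3 - n"
  have st: "0 \<le> s" "s < 1" "0 \<le> t" "t < 1"
    unfolding s_def t_def m_def n_def by linarith+
  have ab: "a = s + t / 2 + (m + n / 2)" "b = s / 2 + t + (m / 2 + n)"
    by (simp_all add: s_def t_def field_simps)
  consider "s + t / 2 < 1/2" "s / 2 + t < 1/2" | "1 \<le> s + t / 2" "1 \<le> s / 2 + t"
    | "t < s" "1/2 \<le> s + t / 2" "s / 2 + t < 1" | "s \<le> t" "1/2 \<le> s / 2 + t" "s + t / 2 < 1"
    using st by linarith
  thus ?thesis
  proof cases
    case 1 show ?thesis by (rule exI[of _ m], rule exI[of _ n]) (use 1 st in \<open>simp add: ab in_hex_def\<close>)
  next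
    case 2 show ?thesis by (rule exI[of _ "m + 1"], rule exI[of _ "n + 1"]) (use 2 st in \<open>simp add: ab in_hex_def field_simps\<close>)
  next
    case 3 show ?thesis by (rule exI[of _ "m + 1"], rule exI[of _ n]) (use 3 st in \<open>simp add: ab in_hex_def field_simps\<close>)
  next
    case 4 show ?thesis by (rule exI[of _ m], rule exI[of _ "n + 1"]) (use 4 st in \<open>simp add: ab in_hex_def field_simps\<close>)
  qed
qed

definition hex_index :: "real ^ 2 \<Rightarrow> int \<times> int" where
  "hex_index x = (SOME (i :: int, j :: int). in_hex (hexA x - (i + j / 2)) (hexB x - (i / 2 + j)))"

lemma hex_index_diff:
  assumes "hex_index x = (i, j)" "hex_index y = (k, l)"
    and uv: "u = i - k" "v = j - l" "p = hexA x - hexA y" "q = hexB x - hexB y"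
  shows "\<bar>p - (u + v / 2)\<bar> < 1" "\<bar>q - (u / 2 + v)\<bar> < 1" "\<bar>(q - p) - (v / 2 - u / 2)\<bar> < 1"
proof -
  have "case hex_index z of (i, j) \<Rightarrow> in_hex (hexA z - (i + j / 2)) (hexB z - (i / 2 + j))" for z
    unfolding hex_index_def by (rule someI_ex) (use hexagon_cover in auto)
  from this[of x] this[of y] assms
  show "\<bar>p - (u + v / 2)\<bar> < 1" "\<bar>q - (u / 2 + v)\<bar> < 1" "\<bar>(q - p) - (v / 2 - u / 2)\<bar> < 1"
    by (auto simp: in_hex_def abs_less_iff field_simps)
qed

section \<open>Upper bounds from sublattice colorings\<close>

lemma chromatic_number_le:
  assumes "proper_coloring V adj C f" "finite C"
  shows "chromatic_number V adj \<le> enat (card (C :: nat set))"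
  unfolding chromatic_number_def using assms by (intro Inf_lower) auto

text \<open>Cells of equal color differ by a vector with \<open>u = 2 * v\<close> modulo 7. The
  distance bound leaves only the zero vector, where the distance is below 1, and the six shortest
  others, where it exceeds \<open>sqrt 7 / 2\<close>.\<close>

lemma chi_plane_le_7: "b \<le> sqrt 7 / 2 \<Longrightarrow> chi_plane b \<le> 7"
proof -
  assume b: "b \<le> sqrt 7 / 2"
  define I J where "I x = fst (hex_index x)" and "J x = snd (hex_index x)" for x
  have IJ: "hex_index x = (I x, J x)" for x by (simp add: I_def J_def)
  define f where "f x = nat ((I x - 2 * J x) mod 7)" for x
  have "proper_coloring UNIV (adj_interval b) {..<7} f"
    unfolding proper_coloring_def
  proof (intro conjI ballI impI)
    show "f \<in> UNIV \<rightarrow> {..<7}" by (auto simp: f_def nat_less_iff)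
    fix x y assume adj: "adj_interval b x y"
    show "f x \<noteq> f y"
    proof
      assume eq: "f x = f y"
      define u v where "u = I x - I y" and "v = J x - J y"
      define p q where "p = hexA x - hexA y" and "q = hexB x - hexB y"
      note cell = hex_index_diff[OF IJ IJ u_def v_def p_def q_def]
      have "(I x - 2 * J x) mod 7 = (I y - 2 * J y) mod 7"
        using eq by (simp add: f_def eq_nat_nat_iff)
      hence "7 dvd (I x - 2 * J x) - (I y - 2 * J y)" by (simp add: mod_eq_dvd_iff)
      then obtain k where "(I x - 2 * J x) - (I y - 2 * J y) = 7 * k" by blast
      hence k: "u = 2 * v + 7 * k" by (simp add: u_def v_def)
      have d2: "(dist x y)\<^sup>2 = eis p q" by (simp add: dist_sq_eis p_def q_def)
      have d: "1 \<le> dist x y" "dist x y \<le> sqrt 7 / 2" using adj b by (auto simp: adj_interval_def)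
      have lo: "1 \<le> eis p q" using d(1) d2 by (metis one_le_power)
      have "(dist x y)\<^sup>2 \<le> (sqrt 7 / 2)\<^sup>2" using d by (intro power_mono) auto
      hence hi: "eis p q \<le> 7 / 4" by (simp add: d2 power_divide)
      \<comment> \<open>Here \<open>z\<^sup>2\<close> is at most 7/3, which is below
        \<open>(31 / 20)\<^sup>2\<close>. This is sharp enough to bound the integers
        \<open>2 * u + v\<close>, \<open>u + 2 * v\<close> and \<open>v - u\<close> by 5 in absolute
        value.\<close>
      have bound: "\<bar>z\<bar> < 31 / 20" if "3 / 4 * z\<^sup>2 \<le> eis p q" for z
      proof -
        have "\<bar>z\<bar>\<^sup>2 < (31 / 20)\<^sup>2" using that hi by (simp add: power2_eq_square)
        thus ?thesis by (rule power2_less_imp_less) simp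
      qed
      have "3 / 4 * p\<^sup>2 \<le> eis p q" "3 / 4 * q\<^sup>2 \<le> eis p q" "3 / 4 * (q - p)\<^sup>2 \<le> eis p q"
        using eis_ge_first[of p q] eis_ge_first[of q p] eis_ge_first[of "q - p" q]
        by (simp_all only: eis_swap[of q p] eis_rotate[of p q])
      hence small: "\<bar>p\<bar> < 31 / 20" "\<bar>q\<bar> < 31 / 20" "\<bar>q - p\<bar> < 31 / 20" using bound by auto
      have "\<bar>2 * u + v\<bar> < 6" using cell(1) small(1) by linarith
      hence b1: "\<bar>5 * v + 14 * k\<bar> < 6" by (simp add: k)
      have "\<bar>u + 2 * v\<bar> < 6" using cell(2) small(2) by linarith
      hence b2: "\<bar>4 * v + 7 * k\<bar> < 6" by (simp add: k)
      have "\<bar>v - u\<bar> < 6" using cell(3) small(3) by linarith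
      hence b3: "\<bar>v + 7 * k\<bar> < 6" by (simp add: k)
      have "k < 2" "- 2 < k" using b2 b3 by linarith+
      then consider "k = 0" | "k = 1" | "k = -1" by linarith
      hence "u = 0 \<and> v = 0 \<or> u = 2 \<and> v = 1 \<or> u = -2 \<and> v = -1 \<or> u = 1 \<and> v = -3 \<or>
          u = -1 \<and> v = 3 \<or> u = 3 \<and> v = -2 \<or> u = -3 \<and> v = 2"
      proof cases
        case 1
        hence "v = -1 \<or> v = 0 \<or> v = 1" using b1 by simp linarith
        thus ?thesis by (elim disjE; simp add: k 1)
      next
        case 2
        hence "v = -3 \<or> v = -2" using b1 b2 by simp linarith
        thus ?thesis by (elim disjE; simp add: k 2)
      next
        case 3
        hence "v = 3 \<or> v = 2" using b1 b2 by simp linarith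
        thus ?thesis by (elim disjE; simp add: k 3)
      qed
      then consider "u = 0 \<and> v = 0" | "u = 2 \<and> v = 1" | "u = -2 \<and> v = -1" | "u = 1 \<and> v = -3"
        | "u = -1 \<and> v = 3" | "u = 3 \<and> v = -2" | "u = -3 \<and> v = 2"
        by blast
      thus False
      proof cases
        case 1
        thus ?thesis using cell lo eis_less_1[of p q] by simp
      next
        \<comment> \<open>In each of the cases after this one a symmetry of \<open>eis\<close> moves
          the offset to \<open>(2, 1)\<close>, so \<open>eis_gt\<close> applies again.\<close>
        case 2
        hence "3 / 2 < p" "1 < q" using cell by (auto simp: abs_less_iff)
        thus ?thesis using hi eis_gt[of p q] by simp
      next
        case 3
        hence "3 / 2 < - p" "1 < - q" using cell by (auto simp: abs_less_iff)
        thus ?thesis using hi eis_gt[of "- p" "- q"] by (simp add: eis_def)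
      next
        case 4
        hence "3 / 2 < - q" "1 < p - q" using cell by (auto simp: abs_less_iff)
        moreover have "eis p q = eis (- q) (p - q)" by (simp add: eis_def power2_eq_square algebra_simps)
        ultimately show ?thesis using hi eis_gt[of "- q" "p - q"] by simp
      next
        case 5
        hence "3 / 2 < q" "1 < q - p" using cell by (auto simp: abs_less_iff)
        moreover have "eis p q = eis q (q - p)" by (simp add: eis_def power2_eq_square algebra_simps)
        ultimately show ?thesis using hi eis_gt[of q "q - p"] by simp
      next
        case 6
        hence "3 / 2 < p - q" "1 < p" using cell by (auto simp: abs_less_iff)
        moreover have "eis p q = eis (p - q) p" by (simp add: eis_def power2_eq_square algebra_simps)
        ultimately show ?thesis using hi eis_gt[of "p - q" p] by simp
      next
        case 7
        hence "3 / 2 < q - p" "1 < - p" using cell by (auto simp: abs_less_iff)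
        moreover have "eis p q = eis (q - p) (- p)" by (simp add: eis_def power2_eq_square algebra_simps)
        ultimately show ?thesis using hi eis_gt[of "q - p" "- p"] by simp
      qed
    qed
  qed
  from chromatic_number_le[OF this] show ?thesis by (simp add: chi_plane_def numeral_eq_enat)
qed

text \<open>The color is the pair of residues modulo 3, written as two ternary digits. Distinct
  cells of equal color differ by three times a lattice vector, which leaves a gap of at least
  \<open>sqrt 3\<close>.\<close>

lemma chi_plane_le_9: "b \<le> sqrt 3 \<Longrightarrow> chi_plane b \<le> 9"
proof -
  assume b: "b \<le> sqrt 3"
  define I J where "I x = fst (hex_index x)" and "J x = snd (hex_index x)" for x
  have IJ: "hex_index x = (I x, J x)" for x by (simp add: I_def J_def)
  define f where "f x = nat (3 * (I x mod 3) + J x mod 3)" for x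
  have "proper_coloring UNIV (adj_interval b) {..<9} f"
    unfolding proper_coloring_def
  proof (intro conjI ballI impI)
    show "f \<in> UNIV \<rightarrow> {..<9}"
    proof
      fix x
      have "I x mod 3 < 3" "J x mod 3 < 3" by simp_all
      thus "f x \<in> {..<9}" by (simp add: f_def nat_less_iff)
    qed
    fix x y assume adj: "adj_interval b x y"
    show "f x \<noteq> f y"
    proof
      assume eq: "f x = f y"
      define u v where "u = I x - I y" and "v = J x - J y"
      define p q where "p = hexA x - hexA y" and "q = hexB x - hexB y"
      note cell = hex_index_diff[OF IJ IJ u_def v_def p_def q_def]
      have digits: "3 * (I x mod 3) + J x mod 3 = 3 * (I y mod 3) + J y mod 3"
        using eq by (simp add: f_def eq_nat_nat_iff)
      have "J z mod 3 div 3 = 0" "J z mod 3 mod 3 = J z mod 3" for z by simp_all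
      hence "I z mod 3 = (3 * (I z mod 3) + J z mod 3) div 3" "J z mod 3 = (3 * (I z mod 3) + J z mod 3) mod 3" for z
        by simp_all
      hence "I x mod 3 = I y mod 3" "J x mod 3 = J y mod 3" using digits by metis+
      hence "3 dvd u" "3 dvd v" by (simp_all add: u_def v_def mod_eq_dvd_iff)
      then obtain m n where mn: "u = 3 * m" "v = 3 * n" by blast
      have d2: "(dist x y)\<^sup>2 = eis p q" by (simp add: dist_sq_eis p_def q_def)
      have d: "1 \<le> dist x y" "dist x y \<le> sqrt 3" using adj b by (auto simp: adj_interval_def)
      have lo: "1 \<le> eis p q" using d(1) d2 by (metis one_le_power)
      have "(dist x y)\<^sup>2 \<le> (sqrt 3)\<^sup>2" using d by (intro power_mono) auto
      hence hi: "eis p q \<le> 3" by (simp add: d2)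
      have bound: "\<bar>z\<bar> \<le> 2" if "3 / 4 * z\<^sup>2 \<le> eis p q" for z
      proof -
        have "\<bar>z\<bar>\<^sup>2 \<le> 2\<^sup>2" using that hi by simp
        thus ?thesis by (rule power2_le_imp_le) simp
      qed
      have "3 / 4 * p\<^sup>2 \<le> eis p q" "3 / 4 * q\<^sup>2 \<le> eis p q" "3 / 4 * (q - p)\<^sup>2 \<le> eis p q"
        using eis_ge_first[of p q] eis_ge_first[of q p] eis_ge_first[of "q - p" q]
        by (simp_all only: eis_swap[of q p] eis_rotate[of p q])
      hence small: "\<bar>p\<bar> \<le> 2" "\<bar>q\<bar> \<le> 2" "\<bar>q - p\<bar> \<le> 2" using bound by auto
      have "\<bar>2 * m + n\<bar> < 2" using cell(1) small(1) unfolding mn by linarith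
      moreover have "\<bar>m + 2 * n\<bar> < 2" using cell(2) small(2) unfolding mn by linarith
      moreover have "\<bar>n - m\<bar> < 2" using cell(3) small(3) unfolding mn by linarith
      ultimately have "m = 0" "n = 0" by presburger+
      thus False using cell mn lo eis_less_1[of p q] by simp
    qed
  qed
  from chromatic_number_le[OF this] show ?thesis by (simp add: chi_plane_def numeral_eq_enat)
qed

section \<open>Points where three colors meet\<close>

text \<open>In dimension at least 2 segments are null sets, and so are finite unions of
  them.\<close>

lemma open_subset_segments_empty:
  fixes R :: "'a::euclidean_space set"
  assumes "finite R" and dim: "2 \<le> DIM('a)" and "U \<subseteq> (\<Union>p\<in>R. \<Union>q\<in>R. closed_segment p q)" "open U"
  shows "U = {}"
proof -
  have "negligible (closed_segment p q)" for p q :: 'a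
    using interior_closed_segment_ge2[OF dim, of p q] negligible_convex_interior[of "closed_segment p q"] by simp
  hence "negligible (\<Union>p\<in>R. \<Union>q\<in>R. closed_segment p q)"
    using assms(1) by (intro negligible_Union) auto
  hence "negligible U" using assms(3) negligible_subset by blast
  thus ?thesis using assms(4) open_not_negligible by blast
qed

text \<open>A step shorter than \<open>b - 1\<close> from distance below 1 stays below
  \<open>b\<close>; equal colors exclude the range from 1 to \<open>b\<close>, so the distance is
  again below 1.\<close>

lemma same_color_chain:
  fixes f :: "'a::metric_space \<Rightarrow> 'c"
  assumes proper: "\<And>x y. 1 \<le> dist x y \<Longrightarrow> dist x y \<le> b \<Longrightarrow> f x \<noteq> f y"
    and "(x, y) \<in> {(u, v). f u = f v \<and> dist u v < b - 1}\<^sup>*"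
  shows "f y = f x \<and> dist x y < 1"
  using assms(2)
proof (induction rule: rtrancl_induct)
  case (step y z)
  have "dist x z < b" using step dist_triangle[of x z y] by auto
  moreover have "f x = f z" using step by auto
  ultimately show ?case using proper[of x z] by force
qed simp

text \<open>Close points of equal color in a finite net \<open>S\<close> are linked, and
  \<open>rep\<close> contracts each linked class to a point. A partition of unity turns
  \<open>rep\<close> into a continuous \<open>g\<close>. Net points near any \<open>x\<close> show
  at most two colors, so \<open>g x\<close> lies on a segment between two representatives; by
  Brouwer these finitely many segments would cover the unit ball.\<close>

lemma three_colors_nearby:
  fixes f :: "'a::euclidean_space \<Rightarrow> 'c"
  assumes dim: "2 \<le> DIM('a)" and "1 < b" and "0 < e"
    and proper: "\<And>x y. 1 \<le> dist x y \<Longrightarrow> dist x y \<le> b \<Longrightarrow> f x \<noteq> f y"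
  shows "\<exists>x y z. dist x y < e \<and> dist x z < e \<and> dist y z < e \<and> f x \<noteq> f y \<and> f x \<noteq> f z \<and> f y \<noteq> f z"
proof (rule ccontr)
  assume none: "\<not> ?thesis"
  hence two: "f x = f y \<or> f x = f z \<or> f y = f z" if "dist x y < e" "dist x z < e" "dist y z < e" for x y z
    using that none by blast
  \<comment> \<open>The three bounds serve in turn: net points near a common \<open>x\<close> are
    within \<open>e\<close> of each other, links are shorter than \<open>b - 1\<close>, and
    \<open>g\<close> moves points by less than 2.\<close>
  define d where "d = min (min e (b - 1)) 1 / 2"
  have d: "0 < d" "2 * d \<le> e" "2 * d \<le> b - 1" "d \<le> 1/2" using assms by (auto simp: d_def)
  \<comment> \<open>Radius 3 is the radius 1 of the ball to be covered plus the bound 2 on the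
    displacement, as \<open>brouwer_surjective\<close> requires.\<close>
  let ?K = "cball (0::'a) 3"
  obtain S where S: "finite S" "?K \<subseteq> (\<Union>s\<in>S. ball s d)"
  proof -
    have "?K \<subseteq> (\<Union>s\<in>?K. ball s d)" using d(1) by force
    from compactE_image[OF compact_cball _ this] show thesis using that by (metis open_ball)
  qed
  define E where "E = {(u, v). u \<in> S \<and> v \<in> S \<and> f u = f v \<and> dist u v < 2 * d}"
  \<comment> \<open>The choice depends only on the class of \<open>x\<close>, so linked points get
    the same representative.\<close>
  define rep where "rep x = (SOME y. (x, y) \<in> E\<^sup>*)" for x
  have rep: "(x, rep x) \<in> E\<^sup>*" for x unfolding rep_def by (rule someI[of _ x]) simp
  have symE: "sym (E\<^sup>*)" by (rule sym_rtrancl) (auto simp: E_def sym_def dist_commute)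
  have rep_eq: "rep x = rep y" if "(x, y) \<in> E" for x y
  proof -
    have "(x, z) \<in> E\<^sup>* \<longleftrightarrow> (y, z) \<in> E\<^sup>*" for z
      using that symE by (meson r_into_rtrancl rtrancl_trans symD)
    thus ?thesis by (simp add: rep_def)
  qed
  have rep_dist: "dist x (rep x) < 1" for x
  proof -
    have "E \<subseteq> {(u, v). f u = f v \<and> dist u v < b - 1}" using d by (auto simp: E_def)
    hence "(x, rep x) \<in> {(u, v). f u = f v \<and> dist u v < b - 1}\<^sup>*" using rep rtrancl_mono by blast
    thus ?thesis using same_color_chain[of b f, OF proper] by blast
  qed
  have rep_S: "rep x \<in> S" if "x \<in> S" for x
    using rep[of x] that by (induction rule: rtrancl_induct) (auto simp: E_def)
  define w where "w s x = max 0 (d - dist x s)" for s x :: 'a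
  define W where "W x = (\<Sum>s\<in>S. w s x)" for x
  define g where "g x = (\<Sum>s\<in>S. (w s x / W x) *\<^sub>R rep s)" for x
  have W: "0 < W x" if "x \<in> ?K" for x
  proof -
    obtain s where "s \<in> S" "dist s x < d" using S(2) \<open>x \<in> ?K\<close> by auto
    thus ?thesis unfolding W_def using S(1)
      by (intro sum_pos2[of _ s]) (auto simp: w_def dist_commute)
  qed
  have contg: "continuous_on ?K g"
    unfolding g_def
  proof (intro continuous_intros)
    show "continuous_on ?K (w s)" for s unfolding w_def by (intro continuous_intros)
    show "continuous_on ?K W" unfolding W_def w_def by (intro continuous_intros)
    show "\<forall>x\<in>?K. W x \<noteq> 0" using W by force
  qed
  define A where "A x = {s \<in> S. dist x s < d}" for x
  have g_hull: "g x \<in> convex hull (rep ` A x)" if "x \<in> ?K" for x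
  proof -
    have Af: "finite (A x)" using S(1) by (simp add: A_def)
    have z: "w s x = 0" if "s \<in> S - A x" for s using that by (auto simp: A_def w_def)
    have sub: "A x \<subseteq> S" by (auto simp: A_def)
    have "g x = (\<Sum>s\<in>A x. (w s x / W x) *\<^sub>R rep s)"
      unfolding g_def by (rule sum.mono_neutral_right[OF S(1) sub]) (use z in auto)
    moreover have "W x = (\<Sum>s\<in>A x. w s x)"
      unfolding W_def by (rule sum.mono_neutral_right[OF S(1) sub]) (use z in auto)
    hence "(\<Sum>s\<in>A x. w s x / W x) = 1"
      using W[OF \<open>x \<in> ?K\<close>] by (simp flip: sum_divide_distrib)
    moreover have "0 \<le> w s x / W x" for s using W[OF \<open>x \<in> ?K\<close>] by (simp add: w_def)
    ultimately show ?thesis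
      using convex_sum[OF Af convex_convex_hull, of "\<lambda>s. w s x / W x" rep "rep ` A x"] hull_subset[of "rep ` A x" convex]
      by (simp add: hull_inc)
  qed
  have g_near: "dist x (g x) < 2" if "x \<in> ?K" for x
  proof -
    have "rep ` A x \<subseteq> ball x 2"
    proof clarify
      fix s assume "s \<in> A x"
      thus "rep s \<in> ball x 2"
        using rep_dist[of s] dist_triangle[of x "rep s" s] d by (auto simp: A_def)
    qed
    hence "convex hull (rep ` A x) \<subseteq> ball x 2" by (simp add: hull_minimal)
    thus ?thesis using g_hull[OF that] by auto
  qed
  have g_segment: "\<exists>p\<in>rep ` S. \<exists>q\<in>rep ` S. g x \<in> closed_segment p q" if "x \<in> ?K" for x
  proof -
    have close: "dist s t < 2 * d" if "s \<in> A x" "t \<in> A x" for s t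
      using that dist_triangle3[of s t x] by (auto simp: A_def)
    have req: "rep s = rep t" if "s \<in> A x" "t \<in> A x" "f s = f t" for s t
      using that close by (intro rep_eq) (auto simp: E_def A_def)
    have tw: "f s = f t \<or> f s = f u \<or> f t = f u" if "s \<in> A x" "t \<in> A x" "u \<in> A x" for s t u
      using that close d by (intro two) (meson less_le_trans)+
    have "A x \<noteq> {}" using g_hull[OF \<open>x \<in> ?K\<close>] by auto
    then obtain s where s: "s \<in> A x" by auto
    obtain t where t: "t \<in> A x" "\<And>u. u \<in> A x \<Longrightarrow> f u = f s \<or> f u = f t"
    proof (cases "\<exists>t\<in>A x. f t \<noteq> f s")
      case True
      then obtain t where "t \<in> A x" "f t \<noteq> f s" by auto
      thus ?thesis using that[of t] tw[OF s] by metis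
    qed (use s that in blast)
    have "rep ` A x \<subseteq> {rep s, rep t}" using req s t by blast
    hence "g x \<in> convex hull {rep s, rep t}" using g_hull[OF \<open>x \<in> ?K\<close>] hull_mono by blast
    thus ?thesis using s t by (auto simp: segment_convex_hull A_def)
  qed
  have "ball 0 1 \<subseteq> (\<Union>p\<in>rep ` S. \<Union>q\<in>rep ` S. closed_segment p q)"
  proof
    fix z :: 'a assume z: "z \<in> ball 0 1"
    have "x + (y - g y) \<in> ?K" if "x \<in> ball 0 1" "y \<in> ?K" for x y
    proof -
      have "norm (x + (y - g y)) \<le> norm x + dist y (g y)"
        unfolding dist_norm by (rule norm_triangle_ineq)
      thus ?thesis using that(1) g_near[OF that(2)] by simp
    qed
    then obtain y where y: "y \<in> ?K" "g y = z"
      using brouwer_surjective[OF compact_cball convex_cball _ contg, of "ball 0 1" z] z by auto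
    show "z \<in> (\<Union>p\<in>rep ` S. \<Union>q\<in>rep ` S. closed_segment p q)"
      using g_segment[OF y(1)] unfolding y(2) by (simp only: UN_iff)
  qed
  hence "ball (0::'a) 1 = {}" using S(1) dim by (intro open_subset_segments_empty[of "rep ` S"]) auto
  thus False by simp
qed

section \<open>Distances in polar coordinates\<close>

definition polar :: "real \<Rightarrow> real \<Rightarrow> real ^ 2" where
  "polar r t = vector [r * cos t, r * sin t]"

lemma dist_polar_sq: "(dist (polar r s) (polar r' t))\<^sup>2 = r\<^sup>2 + r'\<^sup>2 - 2 * r * r' * cos (s - t)"
proof -
  have "(dist (polar r s) (polar r' t))\<^sup>2 = (r * cos s - r' * cos t)\<^sup>2 + (r * sin s - r' * sin t)\<^sup>2"
    by (simp add: dist_norm norm_eq_sqrt_inner inner_vec_def sum_2 polar_def power2_eq_square)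
  also have "\<dots> = r\<^sup>2 * ((sin s)\<^sup>2 + (cos s)\<^sup>2) + r'\<^sup>2 * ((sin t)\<^sup>2 + (cos t)\<^sup>2) - 2 * r * r' * cos (s - t)"
    unfolding cos_diff by algebra
  finally show ?thesis by simp
qed

lemma norm_polar: "norm (polar r t) = \<bar>r\<bar>"
proof -
  have "(norm (polar r t))\<^sup>2 = r\<^sup>2" using dist_polar_sq[of r t 0 0]
    by (simp add: polar_def norm_eq_sqrt_inner inner_vec_def sum_2 dist_norm)
  thus ?thesis by (metis abs_norm_cancel power2_eq_iff abs_minus abs_abs real_sqrt_abs)
qed

text \<open>A chord is at most its arc, by the half-angle formula and
  \<open>\<bar>sin x\<bar> \<le> \<bar>x\<bar>\<close>.\<close>

lemma dist_polar_same_le: "dist (polar r s) (polar r t) \<le> \<bar>r\<bar> * \<bar>s - t\<bar>"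
proof -
  have "1 - cos (s - t) = 2 * (sin ((s - t) / 2))\<^sup>2"
    using cos_double_sin[of "(s - t) / 2"] by (simp add: diff_divide_distrib)
  moreover have "(sin ((s - t) / 2))\<^sup>2 \<le> ((s - t) / 2)\<^sup>2"
    using abs_sin_x_le_abs_x[of "(s - t) / 2"] abs_le_square_iff by blast
  ultimately have "2 * (1 - cos (s - t)) \<le> (s - t)\<^sup>2" by (simp add: power_divide)
  hence "r\<^sup>2 * (2 * (1 - cos (s - t))) \<le> r\<^sup>2 * (s - t)\<^sup>2" by (intro mult_left_mono) auto
  moreover have "(dist (polar r s) (polar r t))\<^sup>2 = r\<^sup>2 * (2 * (1 - cos (s - t)))"
    unfolding dist_polar_sq by (simp add: power2_eq_square algebra_simps)
  ultimately have "(dist (polar r s) (polar r t))\<^sup>2 \<le> (\<bar>r\<bar> * \<bar>s - t\<bar>)\<^sup>2"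
    by (simp only: power_mult_distrib power2_abs)
  thus ?thesis by (rule power2_le_imp_le) simp
qed

text \<open>Otherwise the value would be carried from \<open>u\<close> to \<open>v\<close> in
  finitely many steps shorter than \<open>d\<close>; \<open>g\<close> is arbitrary.\<close>

lemma two_values_nearby:
  fixes g :: "real \<Rightarrow> 'c"
  assumes "g u \<noteq> g v" "0 < d"
  shows "\<exists>s t. \<bar>s - t\<bar> < d \<and> g s \<noteq> g t"
proof (rule ccontr)
  assume "\<not> ?thesis"
  hence const: "g s = g t" if "\<bar>s - t\<bar> < d" for s t using that by blast
  obtain n :: nat where n: "\<bar>v - u\<bar> / d < real n" using reals_Archimedean2 by blast
  hence n0: "0 < real n" using assms(2) by (meson abs_ge_zero divide_nonneg_pos le_less_trans)
  define h where "h k = u + real k * ((v - u) / real n)" for k :: nat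
  have "\<bar>(v - u) / real n\<bar> < d" using n n0 assms(2) by (simp add: field_simps abs_divide)
  hence "g (h (Suc k)) = g (h k)" for k by (intro const) (simp add: h_def algebra_simps add_divide_distrib flip: diff_divide_distrib)
  hence "g (h k) = g (h 0)" for k by (induction k) auto
  from this[of n] show False using assms(1) n0 by (simp add: h_def)
qed

text \<open>The center \<open>a\<close> has three colors within \<open>e\<close>, none of which
  occurs in its annulus. A color change on the circle of radius \<open>r\<close> gives a rim point
  with two colors within \<open>e\<close>, both absent from its own annulus. The margins
  \<open>e\<close> absorb these displacements.\<close>

lemma hub_and_rim:
  assumes f: "proper_coloring UNIV (adj_interval b) C f" and C: "finite C"
    and r: "1 < b" "0 < e" "1 + e \<le> r" "r \<le> b - e"
  obtains a t S p q where "S \<subseteq> C" "card S + 3 = card C" "p \<in> S" "q \<in> S" "p \<noteq> q"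
    "\<And>v. 1 + e \<le> dist a v \<Longrightarrow> dist a v \<le> b - e \<Longrightarrow> f v \<in> S"
    "\<And>v. 1 + e \<le> dist (a + polar r t) v \<Longrightarrow> dist (a + polar r t) v \<le> b - e \<Longrightarrow> f v \<noteq> p \<and> f v \<noteq> q"
proof -
  have proper: "f x \<noteq> f y" if "1 \<le> dist x y" "dist x y \<le> b" for x y
    using f that by (auto simp: proper_coloring_def adj_interval_def)
  have range: "f x \<in> C" for x using f by (auto simp: proper_coloring_def)
  have near: "f v \<noteq> f x" if "dist a x < e" "1 + e \<le> dist a v" "dist a v \<le> b - e" for a v x
    using proper[of v x] that dist_triangle[of a v x] dist_triangle[of v x a] by (auto simp: dist_commute)
  obtain x y z where xyz: "dist x y < e" "dist x z < e" "f x \<noteq> f y" "f x \<noteq> f z" "f y \<noteq> f z"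
    using three_colors_nearby[of b e f] r proper by auto
  define S where "S = C - {f x, f y, f z}"
  have S: "f v \<in> S" if "1 + e \<le> dist x v" "dist x v \<le> b - e" for v
    using near[of x x v] near[of x y v] near[of x z v] that xyz r range by (auto simp: S_def)
  have cS: "card S + 3 = card C"
  proof -
    have "{f x, f y, f z} \<subseteq> C" using range by auto
    moreover have "card {f x, f y, f z} = 3" using xyz by simp
    ultimately show ?thesis using C card_mono[of C "{f x, f y, f z}"] by (simp add: S_def card_Diff_subset)
  qed
  have rim: "dist x (x + polar r t) = r" for t using r norm_polar[of r t] by (simp add: dist_norm)
  \<comment> \<open>An angle of 60 degrees spans a chord of length \<open>r\<close>, which is
    between 1 and \<open>b\<close>, so the circle is not monochromatic.\<close>
  have "(dist (polar r (pi / 3)) (polar r 0))\<^sup>2 = r\<^sup>2" by (simp only: dist_polar_sq) (simp add: cos_60 power2_eq_square)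
  hence "dist (polar r (pi / 3)) (polar r 0) = r" using r by (intro power2_eq_imp_eq[of "dist _ _" r]) auto
  hence "f (x + polar r (pi / 3)) \<noteq> f (x + polar r 0)" using r by (intro proper) auto
  then obtain s t where st: "\<bar>s - t\<bar> < e / r" "f (x + polar r s) \<noteq> f (x + polar r t)"
    using two_values_nearby[of "\<lambda>t. f (x + polar r t)" "pi / 3" 0 "e / r"] r by auto
  have "dist (x + polar r t) (x + polar r s) \<le> r * \<bar>s - t\<bar>"
    using dist_polar_same_le[of r t s] r by (simp add: abs_minus_commute)
  also have "\<dots> < e" using st r by (simp add: field_simps)
  finally have "dist (x + polar r t) (x + polar r s) < e" .
  show thesis
  proof (rule that[of S "f (x + polar r t)" "f (x + polar r s)" x t])
    show "f (x + polar r t) \<in> S" "f (x + polar r s) \<in> S" using S rim r by auto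
    show "f v \<noteq> f (x + polar r t) \<and> f v \<noteq> f (x + polar r s)"
      if "1 + e \<le> dist (x + polar r t) v" "dist (x + polar r t) v \<le> b - e" for v
      using near[of "x + polar r t" "x + polar r t" v] near[of "x + polar r t" "x + polar r s" v] that r
        \<open>dist (x + polar r t) (x + polar r s) < e\<close> by auto
  qed (use S cS st in \<open>auto simp: S_def\<close>)
qed

section \<open>Refutation trees\<close>

datatype 'v tree = Branch 'v "'v tree list"

text \<open>
  In \<open>Branch v ts\<close> the list \<open>ts\<close> follows the order of the palette of \<open>v\<close>, without the colors that
  neighbors of \<open>v\<close> already have in the partial coloring \<open>A\<close>. The conditional, unlike an implication,
  makes the evaluation below skip the vertices of other colors.
\<close>

fun refutes :: "('v \<Rightarrow> 'v \<Rightarrow> bool) \<Rightarrow> ('v \<Rightarrow> 'c list) \<Rightarrow> ('v \<times> 'c) list \<Rightarrow> 'v tree \<Rightarrow> bool"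
  and refutes_all :: "('v \<Rightarrow> 'v \<Rightarrow> bool) \<Rightarrow> ('v \<Rightarrow> 'c list) \<Rightarrow> ('v \<times> 'c) list \<Rightarrow> 'v \<Rightarrow> 'c list \<Rightarrow> 'v tree list \<Rightarrow> bool"
where
  "refutes adj pal A (Branch v ts) =
     refutes_all adj pal A v (filter (\<lambda>c. list_all (\<lambda>p. if snd p = c then \<not> adj (fst p) v else True) A) (pal v)) ts"
| "refutes_all adj pal A v [] ts = True"
| "refutes_all adj pal A v (c # cs) [] = False"
| "refutes_all adj pal A v (c # cs) (t # ts) =
     (refutes adj pal ((v, c) # A) t \<and> refutes_all adj pal A v cs ts)"

text \<open>A coloring that extends \<open>A\<close> gives \<open>v\<close> one of the free colors,
  and the subtree of that color refutes the extended partial coloring. A leaf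
  \<open>Branch v []\<close> passes only if no color is free.\<close>

lemma refutes_sound:
  "refutes adj pal A t \<Longrightarrow> (\<And>u v. adj u v \<Longrightarrow> f u \<noteq> f v) \<Longrightarrow> (\<And>v. f v \<in> set (pal v)) \<Longrightarrow>
     \<forall>(v, c) \<in> set A. f v = c \<Longrightarrow> False"
  "refutes_all adj pal A v cs ts \<Longrightarrow> (\<And>u v. adj u v \<Longrightarrow> f u \<noteq> f v) \<Longrightarrow> (\<And>v. f v \<in> set (pal v)) \<Longrightarrow>
     f v \<in> set cs \<Longrightarrow> \<forall>(v, c) \<in> set A. f v = c \<Longrightarrow> False"
proof (induction adj pal A t and adj pal A v cs ts rule: refutes_refutes_all.induct)
  case (1 adj pal A v ts)
  define free where "free = filter (\<lambda>c. list_all (\<lambda>p. if snd p = c then \<not> adj (fst p) v else True) A) (pal v)"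
  have "f v \<in> set free"
    using "1.prems"(2-4) by (fastforce simp: free_def list_all_iff)
  moreover have "refutes_all adj pal A v free ts" using "1.prems"(1) by (simp add: free_def)
  ultimately show ?case using "1.IH"[folded free_def] "1.prems"(2-4) by blast
next
  case (4 adj pal A v c cs t ts)
  thus ?case by (cases "f v = c") auto
qed auto

section \<open>Seven colors\<close>

text \<open>Vertices are multiples of 20 degrees. Differences 3 and 4 are angles of 60 and 80
  degrees; 15 and 14 are the same angles across the end of a full turn of 18.\<close>

definition circle_adj :: "int \<Rightarrow> int \<Rightarrow> bool" where
  "circle_adj u v \<longleftrightarrow> \<bar>u - v\<bar> \<in> set [3, 4, 14, 15]"

text \<open>Vertex 0 is the rim point where colors 0 and 1 meet, so its neighbors keep only color
  2.\<close>

lemma refutes_circle_adj: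
  "refutes circle_adj (\<lambda>v. if circle_adj 0 v then [2::int] else [0, 1, 2]) []
    (Branch 6
      [Branch 4 [Branch 14 [Branch 10 [Branch 7 [Branch 11 [Branch 8 [Branch 15 [Branch 12 [Branch 9
        [Branch 5 [Branch 1 [Branch 2 [Branch 16 []]]]]]]]]]]]],
       Branch 4 [Branch 14 [Branch 10 [Branch 7 [Branch 11 [Branch 8 [Branch 15 [Branch 12 [Branch 9
        [Branch 5 [Branch 1 [Branch 2 [Branch 16 []]]]]]]]]]]]],
       Branch 3 []])"
  by code_simp

lemma dist_circle_adj:
  assumes "circle_adj u v" "0 \<le> r"
  shows "dist (polar r (t + u * pi / 9)) (polar r (t + v * pi / 9)) \<in> {r, r * sqrt (2 - 2 * cos (4 * pi / 9))}"
proof -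
  let ?d = "dist (polar r (t + u * pi / 9)) (polar r (t + v * pi / 9))"
  have "\<bar>(t + u * pi / 9) - (t + v * pi / 9)\<bar> = \<bar>u - v\<bar> * (pi / 9)"
    by (simp add: abs_mult flip: left_diff_distrib diff_divide_distrib)
  hence "cos ((t + u * pi / 9) - (t + v * pi / 9)) = cos (\<bar>u - v\<bar> * (pi / 9))"
    by (metis cos_abs_real)
  hence "?d\<^sup>2 = r\<^sup>2 * (2 - 2 * cos (\<bar>u - v\<bar> * (pi / 9)))"
    unfolding dist_polar_sq by (simp only: power2_eq_square) (simp add: algebra_simps)
  moreover have "cos (\<bar>u - v\<bar> * (pi / 9)) = 1 / 2 \<or> cos (\<bar>u - v\<bar> * (pi / 9)) = cos (4 * pi / 9)"
  proof -
    consider "\<bar>u - v\<bar> = 3" | "\<bar>u - v\<bar> = 4" | "\<bar>u - v\<bar> = 14" | "\<bar>u - v\<bar> = 15"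
      using assms(1) by (auto simp: circle_adj_def)
    thus ?thesis
    proof cases
      case 1 thus ?thesis using cos_60 by simp
    next
      case 2 thus ?thesis by simp
    next
      case 3
      have "\<bar>u - v\<bar> * (pi / 9) = 2 * pi - 4 * pi / 9" by (simp add: 3)
      thus ?thesis by (simp only: cos_2pi_minus simp_thms)
    next
      case 4
      have "\<bar>u - v\<bar> * (pi / 9) = 2 * pi - pi / 3" by (simp add: 4)
      thus ?thesis by (simp only: cos_2pi_minus cos_60 simp_thms)
    qed
  qed
  moreover have "0 \<le> 2 - 2 * cos (4 * pi / 9)" by simp
  ultimately have "?d\<^sup>2 = r\<^sup>2 \<or> ?d\<^sup>2 = (r * sqrt (2 - 2 * cos (4 * pi / 9)))\<^sup>2"
    by (auto simp: power_mult_distrib)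
  moreover have "0 \<le> r * sqrt (2 - 2 * cos (4 * pi / 9))" using assms(2) by simp
  ultimately have "?d = r \<or> ?d = r * sqrt (2 - 2 * cos (4 * pi / 9))"
    using assms(2) power2_eq_imp_eq zero_le_dist by blast
  thus ?thesis by blast
qed

lemma card_ge_7:
  assumes f: "proper_coloring UNIV (adj_interval b) C f" and C: "finite C"
    and b: "sqrt (2 - 2 * sin (18 * pi / 325)) < b"
  shows "7 \<le> card C"
proof (rule ccontr)
  assume small: "\<not> 7 \<le> card C"
  have proper: "f x \<noteq> f y" if "1 \<le> dist x y" "dist x y \<le> b" for x y
    using f that by (auto simp: proper_coloring_def adj_interval_def)
  define k where "k = sqrt (2 - 2 * cos (4 * pi / 9))"
  have "cos (4 * pi / 9) \<le> cos (pi / 3)" by (rule cos_monotone_0_pi_le) auto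
  hence k1: "1 \<le> k" by (simp add: k_def cos_60)
  \<comment> \<open>Since 18/325 is just below 18/324 = 1/18, the assumed bound on \<open>b\<close>
    lies just above the chord \<open>k\<close> of 80 degrees.\<close>
  have "sin (18 * pi / 325) < sin (pi / 18)" 
    using pi_gt_zero by (intro sin_monotone_2pi; linarith)
  also have "pi / 18 = of_real pi / 2 - 4 * pi / 9" by simp
  also have "sin (of_real pi / 2 - 4 * pi / 9) = cos (4 * pi / 9)" by (rule cos_sin_eq[symmetric])
  finally have "k < sqrt (2 - 2 * sin (18 * pi / 325))" by (simp add: k_def)
  hence kb: "k < b" using b by simp
  \<comment> \<open>Chosen so that scaling the circle from radius 1 to \<open>1 + e\<close> keeps
    the longer chord at most \<open>b - e\<close>.\<close>
  define e where "e = (b - k) / (b + 2)"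
  have e: "0 < e" using kb k1 by (simp add: e_def)
  have "e * (b + 2) = b - k" using kb k1 by (simp add: e_def)
  moreover have "(1 + e) * k + e \<le> k + e * (b + 2)"
  proof -
    have "e * k \<le> e * b" using e kb by simp
    thus ?thesis using e by (simp only: distrib_left distrib_right)
  qed
  ultimately have rk: "(1 + e) * k \<le> b - e" by linarith
  have "1 + e \<le> (1 + e) * k" using e k1 by simp
  hence r: "1 + e \<le> b - e" using rk by linarith
  have "1 < b" using kb k1 by simp
  obtain a t S p q where S: "S \<subseteq> C" "card S + 3 = card C" "p \<in> S" "q \<in> S" "p \<noteq> q"
    and hub: "\<And>v. 1 + e \<le> dist a v \<Longrightarrow> dist a v \<le> b - e \<Longrightarrow> f v \<in> S"
    and rim: "\<And>v. 1 + e \<le> dist (a + polar (1 + e) t) v \<Longrightarrow> dist (a + polar (1 + e) t) v \<le> b - e \<Longrightarrow>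
      f v \<noteq> p \<and> f v \<noteq> q"
    by (rule hub_and_rim[OF f C \<open>1 < b\<close> e order_refl r]) (rule that)
  define P where "P v = a + polar (1 + e) (t + real_of_int v * pi / 9)" for v
  define idx where "idx c = (if c = p then 0 else if c = q then 1 else 2 :: int)" for c
  have fin: "finite S" using S C finite_subset by blast
  have "card (S - {p, q}) = card S - card {p, q}" using S(3,4) by (intro card_Diff_subset) auto
  moreover have "card {p, q} = 2" using S(5) by simp
  ultimately consider "card (S - {p, q}) = 0" | "card (S - {p, q}) = 1" using S(2) small by linarith
  then obtain w where w: "S - {p, q} \<subseteq> {w}"
  proof cases
    case 1
    hence "S - {p, q} = {}" using fin by simp
    \<comment> \<open>A dummy value: with no third color, \<open>idx\<close> is still injective on
      \<open>{p, q, w}\<close>.\<close>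
    thus ?thesis by (intro that[of p]) blast
  next
    case 2
    then obtain w where "S - {p, q} = {w}" by (rule card_1_singletonE)
    thus ?thesis by (intro that[of w]) simp
  qed
  have "inj_on idx {p, q, w}" using S by (auto simp: inj_on_def idx_def)
  moreover have "S \<subseteq> {p, q, w}" using w by blast
  ultimately have inj: "inj_on idx S" by (rule inj_on_subset)
  have fS: "f (P v) \<in> S" for v
    using r e by (intro hub) (auto simp: P_def dist_norm norm_polar)
  have edge: "1 + e \<le> dist (P u) (P v) \<and> dist (P u) (P v) \<le> b - e" if "circle_adj u v" for u v
  proof -
    have "dist (P u) (P v) = 1 + e \<or> dist (P u) (P v) = (1 + e) * k"
      using dist_circle_adj[OF that, of "1 + e" t] e by (simp add: P_def k_def)
    thus ?thesis using r rk \<open>1 + e \<le> (1 + e) * k\<close> by (elim disjE; simp only: order_refl simp_thms)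
  qed
  have "idx (f (P u)) \<noteq> idx (f (P v))" if "circle_adj u v" for u v
  proof -
    have "f (P u) \<noteq> f (P v)" using edge[OF that] e by (intro proper) auto
    thus ?thesis using inj fS by (metis inj_onD)
  qed
  moreover have "idx (f (P v)) \<in> set (if circle_adj 0 v then [2] else [0, 1, 2])" for v
    using rim[of "P v"] edge[of 0 v] by (auto simp: idx_def P_def)
  ultimately show False
    using refutes_sound(1)[OF refutes_circle_adj, of "\<lambda>v. idx (f (P v))"] by simp
qed

section \<open>Nine colors\<close>

text \<open>
  The vertex \<open>(i, k)\<close> stands for the point at angle \<open>2 * pi * k / 240\<close> on the \<open>i\<close>-th of three concentric
  circles; \<open>step_range\<close> bounds the angular differences for which all distances are admissible.
\<close>

definition step_range :: "int \<Rightarrow> int \<Rightarrow> int \<times> int" where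
  "step_range i j =
    (if i = 0 then if j = 0 then (40, 78) else if j = 1 then (28, 56) else (21, 48)
     else if i = 1 then if j = 0 then (28, 56) else if j = 1 then (26, 46) else (24, 42)
     else if j = 0 then (21, 48) else if j = 1 then (24, 42) else (23, 40))"

definition rings_adj :: "int \<times> int \<Rightarrow> int \<times> int \<Rightarrow> bool" where
  "rings_adj u v =
    (let d = \<bar>snd u - snd v\<bar>; e = (if d \<le> 120 then d else 240 - d); r = step_range (fst u) (fst v)
     in fst r \<le> e \<and> e \<le> snd r)"

abbreviation B where "B i k ts \<equiv> Branch (i, k) ts"

text \<open>
  The vertex \<open>(0, 0)\<close> represents the point where the colors 0 and 1 meet; the three vertices colored
  at the start form a triangle of its neighbors. The tree was found by a computer search.
\<close>

lemma refutes_rings_adj: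
  "refutes rings_adj (\<lambda>v. if rings_adj (0, 0) v then [2::int, 3, 4] else [0, 1, 2, 3, 4])
     [((0, 171), 2), ((2, 192), 3), ((2, 219), 4)]
 (B 2 215 [B 2 216 [B 2 217 [B 2 218 [B 2 194 [B 2 195 [B 2 196 [B 0 167 [B 0 169 [B 0 173 [B 0 174 [B 0 175 [B
1 195 [B 2 210 [B 0 180 [B 0 181 [B 0 185 [B 0 189 [B 1 184 [B 1 185 [B 2 237 [B 0 18 [B 0 213 [B 0 162 [B 1
190 [B 2 214 [B 0 145 [B 2 183 [B 2 187 [B 0 157 [B 0 235 []]]], B 2 183 [B 2 187 [B 0 157 [B 0 235 []]]]]]]]]],
B 0 18 [B 0 213 [B 0 162 [B 1 190 [B 2 214 [B 0 150 [B 2 183 [B 2 187 [B 0 157 [B 0 235 []]]], B 2 183 [B 2 187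
[B 0 157 [B 0 235 []]]]]]]]]], B 1 196 [B 1 201 [B 1 203 [B 2 211 [B 2 212 [B 2 214 [B 0 190 [B 0 191 [B 1 190
[B 0 162 [B 1 7 [B 0 213 [B 0 19 [B 2 238 []]], B 0 213 [B 0 19 [B 2 238 []]]]]]]]]]]]]]]]]]]]], B 0 162 [B 0
163 [B 0 164 [B 0 165 [B 0 166 [B 1 190 [B 1 192 [B 1 193 [B 1 194 [B 2 214 [B 0 78 [B 0 156 [B 0 231 [B 2 183
[B 1 207 [B 1 209 [B 1 212 [B 2 206 [B 2 212 [B 2 213 [B 0 153 [B 0 227 [B 0 151 [B 0 218 [B 2 172 [B 0 193 [B
0 194 [B 0 197 [B 0 18 [B 0 19 [B 0 20 [B 0 21 [B 0 28 [B 2 176 [B 1 230 [B 1 231 [B 2 239 [B 2 0 [B 0 191 [B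
0 192 [B 0 40 [B 0 202 [B 0 29 [B 0 30 [B 2 8 [B 2 9 [B 2 226 [B 0 205 [B 0 43 [B 2 22 [B 0 56 [B 1 28 [B 0 84
[B 0 212 [B 0 124 [B 1 0 [B 1 152 [B 0 184 [B 0 96 [B 1 128 []]]]]]]]]]]]]]]]]]], B 0 113 [B 0 202 [B 0 203 [B
0 204 [B 2 178 [B 2 182 [B 1 0 [B 1 232 [B 0 157 [B 0 184 [B 0 176 [B 2 136 [B 2 205 [B 0 98 [B 2 159 [B 2 228
[B 0 126 [B 2 11 [B 0 56 [B 0 32 [B 1 112 [B 2 53 [B 0 84 []]]]]]]]]]]]]]]]]]]]]]]]]]]]]]]]]]]]]]]], B 0 149 [B
1 28 [B 1 32 [B 0 56 [B 2 8 [B 2 21 [B 0 29 [B 0 42 [B 1 45 [B 1 50 [B 0 191 [B 0 82 [B 0 106 [B 2 170 [B 1 78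
[B 0 202 [B 0 134 []]]]]]]]]]]]]]]]]]]]]]]]]]]]], B 0 231 [B 2 183 [B 1 207 [B 1 209 [B 1 212 [B 2 206 [B 2 212
[B 2 213 [B 0 153 [B 0 227 [B 0 151 [B 0 218 [B 2 172 [B 0 193 [B 0 194 [B 0 196 [B 0 197 [B 0 18 [B 0 19 [B 0
20 [B 0 21 [B 0 28 [B 2 176 [B 1 230 [B 1 231 [B 2 239 [B 2 0 [B 0 191 [B 0 192 [B 0 202 [B 0 40 [B 2 178 [B 0
113 [B 0 203 [B 0 204 [B 0 157 [B 2 182 [B 1 0 [B 1 232 [B 0 184 [B 0 176 [B 2 136 [B 2 205 [B 0 98 [B 2 159
[B 2 228 [B 0 126 [B 2 11 [B 0 56 [B 0 32 [B 1 112 [B 2 53 [B 0 84 []]]]]]]]]]]]]]]]]]]]]]], B 0 30 [B 0 34 [B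
0 40 [B 1 6 [B 2 9 [B 2 226 [B 0 205 [B 0 43 [B 2 22 [B 0 56 [B 1 28 [B 0 84 [B 0 212 [B 0 124 [B 1 0 [B 1 152
[B 0 184 [B 0 96 [B 1 128 []]]]]]]]]]]]]]]]]]]]]]]]]]]]]]]]]]]]], B 0 149 [B 1 28 [B 1 32 [B 0 56 [B 2 8 [B 2
21 [B 0 29 [B 0 42 [B 1 45 [B 1 50 [B 0 191 [B 0 82 [B 0 106 [B 2 170 [B 1 78 [B 0 202 [B 0 134
[]]]]]]]]]]]]]]]]]]]]]]]]]]]]], B 1 205 [B 1 207 [B 1 211 [B 0 183 [B 1 185 [B 0 221 [B 0 21 [B 0 27 [B 2 183
[B 0 213 [B 1 239 [B 0 157 [B 2 234 [B 1 213 [B 0 186 [B 1 187 [B 2 207 [B 0 159 []]]]]]]]]]]], B 0 21 [B 0 27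
[B 2 183 [B 0 213 [B 1 239 [B 0 157 [B 2 234 [B 1 213 [B 0 186 [B 1 187 [B 2 207 [B 0 159 []]]]]]]]]]]]]]]]]]],
B 0 213 [B 0 13 [B 0 22 [B 2 234 [B 0 24 [B 0 195 [B 2 30 [B 2 3 [B 0 51 [B 1 45 [B 2 21 []]]]]]]], B 0 184 [B
1 50 [B 2 43 [B 2 234 [B 1 212 [B 2 205 [B 0 64 [B 0 15 [B 0 28 [B 2 228 [B 2 17 [B 0 177 [B 0 38 [B 1 205 [B
0 204 [B 0 205 [B 2 183 [B 0 43 [B 0 135 [B 0 149 [B 1 177 [B 1 184 [B 0 121 [B 0 212 [B 2 150 [B 0 134 [B 0
129 [B 0 56 [B 2 108 [B 1 84 []]]]]]]]]]]]]]]]]]]]]]]]]]]]]]]], B 0 13 [B 0 22 [B 2 234 [B 0 24 [B 0 195 [B 2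
30 [B 2 3 [B 0 51 [B 1 45 [B 2 21 []]]]]]]], B 0 184 [B 1 50 [B 2 43 [B 2 234 [B 1 212 [B 2 205 [B 0 64 [B 0 15
[B 0 28 [B 2 228 [B 2 17 [B 0 177 [B 0 38 [B 1 205 [B 0 204 [B 0 205 [B 2 183 [B 0 43 [B 0 135 [B 0 149 [B 1
177 [B 1 184 [B 0 121 [B 0 212 [B 2 150 [B 0 134 [B 0 129 [B 0 56 [B 2 108 [B 1 84
[]]]]]]]]]]]]]]]]]]]]]]]]]]]]]]]], B 1 28 [B 0 64 [B 2 21 [B 0 42 [B 0 50 [B 1 45 [B 1 50 [B 2 44 [B 2 68 [B 0
89 [B 0 106 [B 0 22 [B 0 23 [B 0 135 [B 1 78 [B 1 79 [B 0 134 [B 1 106 []]]]]]]]], B 0 89 [B 0 106 [B 0 22 [B 0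
23 [B 0 135 [B 1 78 [B 1 79 [B 0 134 [B 1 106 []]]]]]]]]]]]]]]], B 2 30 [B 2 40 [B 0 51 [B 2 21 [B 0 42 [B 1 45
[B 2 44 [B 0 65 [B 0 92 [B 0 19 [B 2 67 []], B 0 19 [B 2 67 []]]]]]]]]]]]]], B 0 153 [B 0 231 [B 2 183 [B 1 207
[B 1 209 [B 1 210 [B 2 206 [B 2 207 [B 2 212 [B 2 213 [B 0 227 [B 2 21 [B 1 45 [B 1 47 [B 1 49 [B 1 50 [B 2 44
[B 0 65 [B 0 69 [B 0 105 [B 2 26 [B 0 97 [B 1 125 [B 0 177 [B 0 179 [B 0 181 [B 0 137 [B 0 19 [B 2 229 [B 0
204 [B 0 42 [B 2 158 [B 0 110 []]]]]]]]]]], B 0 56 [B 1 68 [B 2 35 [B 0 12 [B 2 12 [B 2 229 []]]]]]]]]]]]]]]], B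
1 45 [B 1 47 [B 1 50 [B 2 44 [B 2 48 [B 0 65 [B 0 67 [B 0 69 [B 2 23 [B 2 26 [B 0 71 [B 0 192 [B 0 149 [B 2
170 [B 0 134 [B 0 214 [B 1 162 [B 0 52 [B 0 106 [B 2 31 [B 0 29 [B 2 8 []]]]]]]]]], B 0 27 [B 2 3 [B 0 214 [B 0
219 [B 0 52 [B 0 57 [B 2 31 [B 1 29 [B 2 8 [B 0 29 [B 0 191 [B 2 50 [B 0 113 [B 0 85 [B 1 57
[]]]]]]]]]]]]]]]]]]]]]]]]]]], B 0 213 [B 0 135 [B 1 163 [B 2 165 [B 0 192 [B 0 195 [B 0 186 [B 0 189 [B 2 40 [B
0 15 [B 2 0 [B 2 234 [B 0 21 []]]], B 0 61 [B 0 15 [B 1 5 [B 2 234 [B 0 33 []]]]]]]]]]]]]]]]]]]]]]]]], B 0 231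
[B 2 183 [B 1 207 [B 2 206 [B 2 207 [B 2 212 [B 0 227 [B 2 21 [B 1 45 [B 1 49 [B 1 50 [B 2 44 [B 0 65 [B 0 68
[B 0 105 [B 2 26 [B 0 12 [B 0 84 [B 0 204 [B 1 55 [B 2 225 [B 2 31 [B 2 8 []]]]]], B 1 68 [B 2 229 [B 0 96 [B 0
204 [B 1 124 [B 0 42 [B 0 176 [B 0 178 [B 0 109 [B 0 136 [B 2 157 []]]]]]]]]]]]]]]]]]]], B 1 45 [B 1 47 [B 1 50
[B 2 44 [B 2 48 [B 0 65 [B 0 67 [B 0 69 [B 2 23 [B 2 26 [B 0 71 [B 0 194 [B 0 149 [B 2 170 [B 0 134 [B 0 214
[B 1 162 [B 0 52 [B 0 106 [B 2 31 [B 0 29 [B 2 8 []]]]]]]]]], B 0 27 [B 2 3 [B 0 214 [B 0 219 [B 0 52 [B 0 57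
[B 2 31 [B 1 29 [B 2 8 [B 0 29 [B 0 191 [B 2 50 [B 0 113 [B 0 85 [B 1 57 []]]]]]]]]]]]]]]]]]]]]]]]]]], B 0 213
[B 0 135 [B 1 163 [B 2 165 [B 0 191 [B 0 186 [B 2 30 [B 0 57 [B 2 234 [B 2 36 [B 0 15 []]]], B 0 51 [B 0 69 [B
1 1 [B 0 29 []]]]]]]]]]]]]]]]]]], B 0 193 [B 0 194 [B 0 195 [B 0 196 [B 0 197 [B 0 198 [B 1 184 [B 1 210 [B 1
212 [B 2 208 [B 2 209 [B 0 133 [B 2 174 [B 2 177 [B 0 126 [B 0 134 [B 2 154 [B 0 212 [B 0 199 [B 0 201 [B 0
202 [B 2 178 [B 2 180 [B 0 40 [B 2 181 [B 1 156 [B 0 229 [B 0 184 [B 0 188 [B 0 151 [B 2 10 [B 1 134 [B 2 205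
[B 2 172 [B 0 34 [B 0 35 [B 0 106 [B 0 226 [B 1 131 [B 0 28 [B 0 148 [B 2 169 [B 0 121 [B 2 142 [B 2 82 [B 0
103 [B 2 47 [B 0 26 []]], B 1 56 [B 0 94 [B 1 28 [B 2 14 [B 0 58 [B 2 228 [B 2 37 [B 0 16
[]]]]]]]]]]]]]]]]]]]]]]]]]]]]]]]]]]]]]]]]], B 2 174 [B 2 177 [B 0 126 [B 0 134 [B 0 135 [B 2 154 [B 0 212 [B 0
213 [B 0 199 [B 0 201 [B 0 202 [B 2 178 [B 2 180 [B 0 40 [B 2 181 [B 1 156 [B 0 229 [B 0 184 [B 0 185 [B 2 10
[B 1 134 [B 2 205 [B 0 31 [B 0 32 [B 0 106 [B 0 226 [B 0 28 [B 0 148 [B 2 169 [B 0 121 [B 1 129 [B 2 142 [B 0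
51 [B 1 14 [B 2 21 [B 2 228 [B 1 56 [B 2 44 [B 2 80 [B 0 23 [B 0 101 []]]]]]]], B 0 94 [B 2 11 [B 2 21 [B 2 79
[B 2 228 [B 0 58 [B 0 16 [B 2 37
[]]]]]]]]]]]]]]]]]]]]]]]]]]]]]]]]]]]]]]]]]]]]]]]]]]]]]]]]]]]]]]]]]]]]]]]]]]]]]]])"
  by code_simp

section \<open>Certified distances between the rings\<close>

lemma cos_taylor_8:
  fixes x :: real
  shows "\<bar>cos x - (1 - x^2 / 2 + x^4 / 24 - x^6 / 720 + x^8 / 40320)\<bar> \<le> x^10 / 3628800"
proof -
  obtain t where "cos x = (\<Sum>m<10. cos_coeff m * x ^ m) + cos (t + 1/2 * real 10 * pi) / fact 10 * x ^ 10"
    using Maclaurin_cos_expansion[of x 10] by blast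
  moreover have "{..<10} = {0, 1, 2, 3, 4, 5, 6, 7, 8, 9 :: nat}" by auto
  hence "(\<Sum>m<10. cos_coeff m * x ^ m) = 1 - x^2 / 2 + x^4 / 24 - x^6 / 720 + x^8 / 40320"
    by (simp add: cos_coeff_def fact_numeral)
  moreover have "\<bar>cos (t + 1/2 * real 10 * pi) / fact 10 * x ^ 10\<bar> \<le> x^10 / 3628800"
  proof -
    have "\<bar>cos (t + 1/2 * real 10 * pi)\<bar> * x ^ 10 \<le> 1 * x ^ 10" by (intro mult_right_mono) auto
    thus ?thesis by (simp add: fact_numeral abs_mult power_even_abs)
  qed
  ultimately show ?thesis by simp
qed

text \<open>Monotonicity replaces an argument containing \<open>pi\<close> by a rational
  \<open>y\<close>, where the Taylor bound is plain arithmetic.\<close>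

lemma cos_ge_rational:
  fixes x :: real
  assumes "0 \<le> x" "x \<le> y" "y \<le> 3" "c \<le> 1 - y^2 / 2 + y^4 / 24 - y^6 / 720 + y^8 / 40320 - y^10 / 3628800"
  shows "c \<le> cos x"
proof -
  have "cos y \<le> cos x" using assms pi_gt3 by (intro cos_monotone_0_pi_le) auto
  thus ?thesis using cos_taylor_8[of y] assms(4) by linarith
qed

lemma cos_le_rational:
  fixes x :: real
  assumes "0 \<le> y" "y \<le> x" "x \<le> 3" "1 - y^2 / 2 + y^4 / 24 - y^6 / 720 + y^8 / 40320 + y^10 / 3628800 \<le> c"
  shows "cos x \<le> c"
proof -
  have "cos x \<le> cos y" using assms pi_gt3 by (intro cos_monotone_0_pi_le) auto
  thus ?thesis using cos_taylor_8[of y] assms(4) by linarith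
qed

text \<open>All three radii lie between 10001/10000 and 17142/10000, the outer two close to the
  ends. As in \<open>step_range\<close>, every index other than 0 and 1 means the third
  circle.\<close>

definition radius :: "int \<Rightarrow> real" where
  "radius i = (if i = 0 then 10002/10000 else if i = 1 then 3/2 else 1714/1000)"

text \<open>By the law of cosines the two quotients are the cosines of the angles at which points of
  circles \<open>i\<close> and \<open>j\<close> have distance 10001/10000 and 17142/10000.\<close>

lemma step_range_bounds:
  assumes "step_range i j = (l, h)"
  shows "cos (l * pi / 120) \<le> ((radius i)\<^sup>2 + (radius j)\<^sup>2 - (10001/10000)\<^sup>2) / (2 * radius i * radius j)"
    and "((radius i)\<^sup>2 + (radius j)\<^sup>2 - (17142/10000)\<^sup>2) / (2 * radius i * radius j) \<le> cos (h * pi / 120)"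
    and "0 \<le> l" "h \<le> 120"
proof -
  \<comment> \<open>Each \<open>y\<close> is the angle to four decimals, rounded down for upper
    bounds on the cosine and up for lower bounds.\<close>
  have c28: "cos (28 * pi / 120) \<le> 746/1000"
    by (rule cos_le_rational[where y = "7330/10000"]) (use pi_approx in \<open>simp_all add: power_divide\<close>)
  have c21: "cos (21 * pi / 120) \<le> 855/1000"
    by (rule cos_le_rational[where y = "5497/10000"]) (use pi_approx in \<open>simp_all add: power_divide\<close>)
  have c26: "cos (26 * pi / 120) \<le> 7775/10000"
    by (rule cos_le_rational[where y = "6806/10000"]) (use pi_approx in \<open>simp_all add: power_divide\<close>)
  have c24: "cos (24 * pi / 120) \<le> 812/1000"
    by (rule cos_le_rational[where y = "6283/10000"]) (use pi_approx in \<open>simp_all add: power_divide\<close>)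
  have c23: "cos (23 * pi / 120) \<le> 827/1000"
    by (rule cos_le_rational[where y = "6021/10000"]) (use pi_approx in \<open>simp_all add: power_divide\<close>)
  have c78: "- 465/1000 \<le> cos (78 * pi / 120)"
    by (rule cos_ge_rational[where y = "20421/10000"]) (use pi_approx in \<open>simp_all add: power_divide\<close>)
  have c56: "1042/10000 \<le> cos (56 * pi / 120)"
    by (rule cos_ge_rational[where y = "14661/10000"]) (use pi_approx in \<open>simp_all add: power_divide\<close>)
  have c48: "3/10 \<le> cos (48 * pi / 120)"
    by (rule cos_ge_rational[where y = "12567/10000"]) (use pi_approx in \<open>simp_all add: power_divide\<close>)
  have c46: "352/1000 \<le> cos (46 * pi / 120)"
    by (rule cos_ge_rational[where y = "12043/10000"]) (use pi_approx in \<open>simp_all add: power_divide\<close>)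
  have c42: "446/1000 \<le> cos (42 * pi / 120)"
    by (rule cos_ge_rational[where y = "10996/10000"]) (use pi_approx in \<open>simp_all add: power_divide\<close>)
  have c40: "cos (40 * pi / 120) = 1 / 2" using cos_60 by simp
  note cs = c28 c21 c26 c24 c23 c78 c56 c48 c46 c42 c40
  show "cos (l * pi / 120) \<le> ((radius i)\<^sup>2 + (radius j)\<^sup>2 - (10001/10000)\<^sup>2) / (2 * radius i * radius j)"
    using assms cs by (auto simp: step_range_def radius_def power_divide split: if_splits)
  show "((radius i)\<^sup>2 + (radius j)\<^sup>2 - (17142/10000)\<^sup>2) / (2 * radius i * radius j) \<le> cos (h * pi / 120)"
    using assms cs by (auto simp: step_range_def radius_def power_divide split: if_splits)
  show "0 \<le> l" "h \<le> 120" using assms by (auto simp: step_range_def split: if_splits)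
qed

text \<open>Cosine decreases on \<open>[0, pi]\<close>, so the ends of the step range suffice once
  angles above a half turn are reflected.\<close>

lemma dist_rings_adj:
  fixes u v :: "int \<times> int"
  assumes "rings_adj u v"
  shows "dist (polar (radius (fst u)) (t + of_int (snd u) * pi / 120)) (polar (radius (fst v)) (t + of_int (snd v) * pi / 120))
    \<in> {10001/10000 .. 17142/10000}"
proof -
  define d where "d = \<bar>snd u - snd v\<bar>"
  define e where "e = (if d \<le> 120 then d else 240 - d)"
  obtain l h where lh: "step_range (fst u) (fst v) = (l, h)" by fastforce
  have le: "l \<le> e" "e \<le> h" using assms lh by (auto simp: rings_adj_def Let_def d_def e_def)
  note b = step_range_bounds[OF lh]
  let ?r = "radius (fst u)" and ?s = "radius (fst v)"
  let ?x = "(t + of_int (snd u) * pi / 120) - (t + of_int (snd v) * pi / 120)"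
  let ?d = "dist (polar ?r (t + of_int (snd u) * pi / 120)) (polar ?s (t + of_int (snd v) * pi / 120))"
  have "\<bar>?x\<bar> = d * (pi / 120)"
    by (simp add: d_def abs_mult flip: left_diff_distrib diff_divide_distrib)
  hence "cos ?x = cos (d * (pi / 120))" by (metis cos_abs_real)
  also have "\<dots> = cos (e * pi / 120)"
  proof (cases "d \<le> 120")
    case False
    hence "d * (pi / 120) = 2 * pi - e * pi / 120" by (simp add: e_def field_simps)
    thus ?thesis by (simp only: cos_2pi_minus)
  qed (simp add: e_def)
  finally have c: "cos ?x = cos (e * pi / 120)" .
  have "real_of_int h \<le> 120" using b(4) by linarith
  hence "h * pi / 120 \<le> pi" by (simp add: field_simps)
  moreover have "l * pi / 120 \<le> e * pi / 120" "e * pi / 120 \<le> h * pi / 120" "0 \<le> l * pi / 120"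
    using le b(3) by (auto intro!: divide_right_mono mult_right_mono)
  ultimately have "cos ?x \<le> cos (l * pi / 120)" "cos (h * pi / 120) \<le> cos ?x"
    unfolding c by (intro cos_monotone_0_pi_le; linarith)+
  moreover have pos: "0 < 2 * ?r * ?s" by (simp add: radius_def)
  ultimately have "cos ?x * (2 * ?r * ?s) \<le> ?r\<^sup>2 + ?s\<^sup>2 - (10001/10000)\<^sup>2"
    "?r\<^sup>2 + ?s\<^sup>2 - (17142/10000)\<^sup>2 \<le> cos ?x * (2 * ?r * ?s)"
    using pos_le_divide_eq[OF pos] pos_divide_le_eq[OF pos] order_trans[OF _ b(1)] order_trans[OF b(2)] by blast+
  hence "(10001/10000)\<^sup>2 \<le> ?d\<^sup>2" "?d\<^sup>2 \<le> (17142/10000)\<^sup>2"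
    unfolding dist_polar_sq mult.commute[of "cos _"] by linarith+
  hence "10001/10000 \<le> ?d" "?d \<le> 17142/10000" by (auto intro: power2_le_imp_le)
  thus ?thesis by simp
qed

lemma card_ge_9:
  assumes f: "proper_coloring UNIV (adj_interval b) C f" and C: "finite C"
    and b: "17143/10000 \<le> b"
  shows "9 \<le> card C"
proof (rule ccontr)
  assume small: "\<not> 9 \<le> card C"
  \<comment> \<open>Lowering \<open>b\<close> only removes edges; with this value and margin 1/10000
    all later estimates are rational.\<close>
  have f': "proper_coloring UNIV (adj_interval (17143/10000)) C f"
    using f b by (auto simp: proper_coloring_def adj_interval_def)
  have proper: "f x \<noteq> f y" if "1 \<le> dist x y" "dist x y \<le> 17143/10000" for x y
    using f' that by (auto simp: proper_coloring_def adj_interval_def)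
  have r: "1 < (17143/10000 :: real)" "0 < (1/10000 :: real)" "1 + 1/10000 \<le> radius 0"
    "radius 0 \<le> 17143/10000 - 1/10000"
    by (simp_all add: radius_def)
  obtain a t S p q where S: "S \<subseteq> C" "card S + 3 = card C" "p \<in> S" "q \<in> S" "p \<noteq> q"
    and hub: "\<And>v. 1 + 1/10000 \<le> dist a v \<Longrightarrow> dist a v \<le> 17143/10000 - 1/10000 \<Longrightarrow> f v \<in> S"
    and rim: "\<And>v. 1 + 1/10000 \<le> dist (a + polar (radius 0) t) v \<Longrightarrow>
      dist (a + polar (radius 0) t) v \<le> 17143/10000 - 1/10000 \<Longrightarrow> f v \<noteq> p \<and> f v \<noteq> q"
    by (rule hub_and_rim[OF f' C r]) (rule that)
  define P where "P v = a + polar (radius (fst v)) (t + real_of_int (snd v) * pi / 120)" for v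
  have fS: "f (P v) \<in> S" for v
    by (intro hub) (auto simp: P_def dist_norm norm_polar radius_def)
  have edge: "dist (P u) (P v) \<in> {10001/10000 .. 17142/10000}" if "rings_adj u v" for u v
    using dist_rings_adj[OF that, of t] by (simp add: P_def)
  have neq: "f (P u) \<noteq> f (P v)" if "rings_adj u v" for u v
    using edge[OF that] by (intro proper) auto
  have avoid: "f (P v) \<noteq> p \<and> f (P v) \<noteq> q" if "rings_adj (0, 0) v" for v
    using rim[of "P v"] edge[OF that] by (auto simp: P_def)
  \<comment> \<open>The colors of the triangle fixed in the refutation. With at most 8 colors in
    all, \<open>S\<close> has at most 5, so these three together with \<open>p\<close> and
    \<open>q\<close> exhaust it.\<close>
  define x y z where "x = f (P (0, 171))" and "y = f (P (2, 192))" and "z = f (P (2, 219))"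
  have "distinct [p, q, x, y, z]"
    using avoid[of "(0, 171)"] avoid[of "(2, 192)"] avoid[of "(2, 219)"]
      neq[of "(0, 171)" "(2, 192)"] neq[of "(0, 171)" "(2, 219)"] neq[of "(2, 192)" "(2, 219)"] S(5)
    by (auto simp: x_def y_def z_def rings_adj_def step_range_def)
  hence dist: "distinct [p, q, x, y, z]" and "card {p, q, x, y, z} = 5" by auto
  moreover have "{p, q, x, y, z} \<subseteq> S" using S fS by (auto simp: x_def y_def z_def)
  moreover have "finite S" using S C finite_subset by blast
  ultimately have Seq: "S = {p, q, x, y, z}"
    using small S(2) card_seteq[of S "{p, q, x, y, z}"] by simp
  define idx where "idx c = (if c = p then 0 else if c = q then 1 else if c = x then 2 else if c = y then 3 else 4 :: int)" for c
  have inj: "inj_on idx S" using dist by (auto simp: Seq inj_on_def idx_def)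
  have "idx (f (P u)) \<noteq> idx (f (P v))" if "rings_adj u v" for u v
    using neq[OF that] inj fS by (metis inj_onD)
  moreover have "idx (f (P v)) \<in> set (if rings_adj (0, 0) v then [2, 3, 4] else [0, 1, 2, 3, 4])" for v
    using avoid[of v] by (auto simp: idx_def)
  moreover have "idx x = 2" "idx y = 3" "idx z = 4" using dist by (auto simp: idx_def)
  ultimately show False
    using refutes_sound(1)[OF refutes_rings_adj, of "\<lambda>v. idx (f (P v))"] by (simp add: x_def y_def z_def)
qed

text \<open>The sine is the cosine of \<open>31 * pi / 90\<close>, and
  \<open>(17143/10000)\<^sup>2\<close> is just below 2 + 2 * 0.46942.\<close>

lemma chord_gt: "17143/10000 < sqrt (2 + 2 * sin (7 * pi / 45))"
proof -
  have "46942/100000 \<le> cos (31 * pi / 90)"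
    by (rule cos_ge_rational[where y = "108211/100000"]) (use pi_approx in \<open>auto simp: power_divide\<close>)
  also have "31 * pi / 90 = of_real pi / 2 - 7 * pi / 45" by simp
  also have "cos (of_real pi / 2 - 7 * pi / 45) = sin (7 * pi / 45)" by (rule sin_cos_eq[symmetric])
  finally show ?thesis by (intro real_less_rsqrt) (simp add: power_divide)
qed

section \<open>Assembly of the upper and lower bounds\<close>

lemma chi_plane_ge:
  assumes "\<And>C f. finite C \<Longrightarrow> proper_coloring UNIV (adj_interval b) C f \<Longrightarrow> n \<le> card (C :: nat set)"
  shows "enat n \<le> chi_plane b"
  unfolding chi_plane_def chromatic_number_def
  using assms by (intro Inf_greatest) auto

theorem corollary3p4:
  shows "(\<forall>b :: real. b \<in> {sqrt (2 - 2 * sin (18 * pi / 325)) <.. sqrt 7 / 2} \<longrightarrow> chi_plane b = 7)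
       \<and> (\<forall>b :: real. b \<in> {sqrt (2 + 2 * sin (7 * pi / 45)) <.. sqrt 3} \<longrightarrow> chi_plane b = 9)"
proof (intro conjI allI impI)
  fix b :: real
  assume b: "b \<in> {sqrt (2 - 2 * sin (18 * pi / 325)) <.. sqrt 7 / 2}"
  have "enat 7 \<le> chi_plane b"
    by (rule chi_plane_ge) (use b card_ge_7 in auto)
  thus "chi_plane b = 7"
    using b chi_plane_le_7[of b] by (intro antisym) (auto simp: numeral_eq_enat)
next
  fix b :: real
  assume b: "b \<in> {sqrt (2 + 2 * sin (7 * pi / 45)) <.. sqrt 3}"
  have "enat 9 \<le> chi_plane b"
    by (rule chi_plane_ge) (use b card_ge_9[of b] chord_gt in force)
  thus "chi_plane b = 9"
    using b chi_plane_le_9[of b] by (intro antisym) (auto simp: numeral_eq_enat)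
qed

end
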